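(* Let $L>0$ and let $m,n$ be continuous functions on $[0,L]$, bounded below by some positive constant. Fix an angle $\theta\in(0,\pi/2)$. For each choice of sign $\pm$, the curves $\mathcal{C}_k^\pm$ of the Fučík spectrum of the problem $-u''=\alpha m(x)u^+-\beta n(x)u^-$ on $(0,L)$, $u(0)=u(L)=0$, have the following asymptotic behavior in the region $\mathcal{K}_\theta$: if $(\alpha_k^\pm,\beta_k^\pm)\in\mathcal{C}_k^\pm\cap\mathcal{K}_\theta$, then $$1\sim\frac{\pi k}{2}\left(\int_0^L\Big((\alpha_k^\pm m)^{-\frac12}+(\beta_k^\pm n)^{-\frac12}\Big)^{-1}dx\right)^{-1}\qquad\text{as }k\to\infty.$$ Moreover, if for some $\gamma>1$ the function $\big(m^{-\frac12}+(nt)^{-\frac12}\big)^{-1}$ satisfies the $\gamma$-condition for every $t>0$, then for all $\delta\in[\frac1\gamma,1]$, $$1=\frac{\pi k}{2}\left(\int_0^L\Big((\alpha_k^\pm m)^{-\frac12}+(\beta_k^\pm n)^{-\frac12}\Big)^{-1}dx\right)^{-1}+O(k^{\delta})\qquad\text{as }k\to\infty.$$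
   Context: For a function $u$, $u^\pm=\max\{0,\pm u\}$. For weights $m,n\in C[0,L]$, each bounded below by a positive constant, consider, for $\alpha,\beta>0$, the problem $$-u''=\alpha\, m(x)u^+-\beta\, n(x)u^-\ \text{ in }(0,L),\qquad u(0)=u(L)=0.$$ The Fučík spectrum $\Sigma$ is the set of pairs $(\alpha,\beta)$ for which this problem has a nontrivial solution. For $k\in\mathbb{N}$, $\mathcal{C}_k^+$ (resp. $\mathcal{C}_k^-$) is the set of pairs $(\alpha,\beta)$ for which there is a nontrivial solution $u$ with exactly $k$ nodal domains in $(0,L)$ (i.e. $k+1$ zeros in $[0,L]$) and $u'(0)>0$ (resp. $u'(0)<0$). $\mathcal{K}_\theta$ denotes the region of the first quadrant, symmetric with respect to the line $x=y$, lying between two rays through the origin which form an angle $\theta$. The notation $f(k)\sim g(k)$ as $k\to\infty$ means $\lim_{k\to\infty}f(k)/g(k)=1$. Given $\gamma>0$, a function $h$ on $[0,L]$ satisfies the $\gamma$-condition if $h$ is continuous, there exist constants $0<h_1\le h\le h_2<\infty$, and there is a constant $C$ such that $$\int_I|h-h_I|\,dx\le C|I|^\gamma$$ for every interval $I\subset(0,L)$, where $h_I=\frac1{|I|}\int_I h(x)\,dx$. *)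

theory Defs
  imports "HOL-Analysis.Analysis" "HOL-Library.Landau_Symbols"
begin

definition pos_part :: "real \<Rightarrow> real" where
  "pos_part y = max 0 y"

definition neg_part :: "real \<Rightarrow> real" where
  "neg_part y = max 0 (- y)"

definition weight :: "real \<Rightarrow> (real \<Rightarrow> real) \<Rightarrow> bool" where
  "weight L m \<longleftrightarrow> continuous_on {0..L} m \<and> (\<exists>c>0. \<forall>x\<in>{0..L}. c \<le> m x)"

(* Classical solutions u in C^1[0,L] with u'' existing (hence continuous) on (0,L);
   the function v is u', one-sided at the end points. Values of u outside [0,L] play no role. *)
definition fucik_solution ::
  "real \<Rightarrow> (real \<Rightarrow> real) \<Rightarrow> (real \<Rightarrow> real) \<Rightarrow> real \<Rightarrow> real \<Rightarrow> (real \<Rightarrow> real) \<Rightarrow> bool" where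
  "fucik_solution L m n \<alpha> \<beta> u \<longleftrightarrow>
     (\<exists>v. (\<forall>x\<in>{0..L}. (u has_real_derivative v x) (at x within {0..L})) \<and>
          continuous_on {0..L} v \<and>
          (\<forall>x\<in>{0<..<L}. (v has_real_derivative
              - (\<alpha> * m x * pos_part (u x) - \<beta> * n x * neg_part (u x))) (at x))) \<and>
     u 0 = 0 \<and> u L = 0"

definition nodal_domains :: "real \<Rightarrow> (real \<Rightarrow> real) \<Rightarrow> real set set" where
  "nodal_domains L u = components {x \<in> {0<..<L}. u x \<noteq> 0}"

(* The sign s = 1 gives the set with superscript +, s = -1 the one with superscript -.
   A solution with a nodal domain is automatically nontrivial, so the set is empty for k = 0. *)
definition fucik_curve ::
  "real \<Rightarrow> (real \<Rightarrow> real) \<Rightarrow> (real \<Rightarrow> real) \<Rightarrow> real \<Rightarrow> nat \<Rightarrow> (real \<times> real) set" where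
  "fucik_curve L m n s k =
     {(\<alpha>, \<beta>). 0 < \<alpha> \<and> 0 < \<beta> \<and>
        (\<exists>u. fucik_solution L m n \<alpha> \<beta> u \<and> (\<exists>x\<in>{0..L}. u x \<noteq> 0) \<and>
             finite (nodal_domains L u) \<and> card (nodal_domains L u) = k \<and>
             (\<exists>d. (u has_real_derivative d) (at 0 within {0..L}) \<and> 0 < s * d))}"

(* In the open first quadrant arctan (y / x) is the polar angle of (x, y), so this is the closed
   sector of opening angle \<theta> around the diagonal, without its vertex. *)
definition sector :: "real \<Rightarrow> (real \<times> real) set" where
  "sector \<theta> = {(x, y). 0 < x \<and> 0 < y \<and> \<bar>arctan (y / x) - pi / 4\<bar> \<le> \<theta> / 2}"

definition mean_on :: "real set \<Rightarrow> (real \<Rightarrow> real) \<Rightarrow> real" where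
  "mean_on I h = integral I h / measure lebesgue I"

definition gamma_condition :: "real \<Rightarrow> real \<Rightarrow> (real \<Rightarrow> real) \<Rightarrow> bool" where
  "gamma_condition \<gamma> L h \<longleftrightarrow>
     continuous_on {0..L} h \<and>
     (\<exists>h1 h2. 0 < h1 \<and> (\<forall>x\<in>{0..L}. h1 \<le> h x \<and> h x \<le> h2)) \<and>
     (\<exists>C. \<forall>I. is_interval I \<and> I \<subseteq> {0<..<L} \<and> 0 < measure lebesgue I \<longrightarrow>
        integral I (\<lambda>x. \<bar>h x - mean_on I h\<bar>) \<le> C * measure lebesgue I powr \<gamma>)"

definition harmonic_weight :: "(real \<Rightarrow> real) \<Rightarrow> (real \<Rightarrow> real) \<Rightarrow> real \<Rightarrow> real" where
  "harmonic_weight p q x = inverse (p x powr (-1/2) + q x powr (-1/2))"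

end

theory Submission
  imports Defs
begin

text \<open>
On a nodal interval a solution solves one of the two linear equations \<open>-u'' = \<alpha> m u\<close> and
\<open>-u'' = \<beta> n u\<close>. Sturm comparison with a sine shows that the length of the interval is \<open>\<pi>\<close> divided by
the frequency, \<open>sqrt (\<alpha> m)\<close> or \<open>sqrt (\<beta> n)\<close>, up to the variation of the weight over the interval
(\<open>nodal_length_le\<close> and \<open>nodal_length_ge\<close>). All zeros are simple, so there are finitely many of them
and the two types of intervals alternate. The union of two neighbouring intervals therefore has
length about \<open>\<pi> ((\<alpha> m)\<^sup>-\<^sup>1\<^sup>/\<^sup>2 + (\<beta> n)\<^sup>-\<^sup>1\<^sup>/\<^sup>2)\<close>, and the harmonic weight
\<open>H = ((\<alpha> m)\<^sup>-\<^sup>1\<^sup>/\<^sup>2 + (\<beta> n)\<^sup>-\<^sup>1\<^sup>/\<^sup>2)\<^sup>-\<^sup>1\<close> integrates to about \<open>\<pi>\<close> over it. With \<open>k\<close> nodal intervals,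
the integral of \<open>H\<close> over \<open>[0, L]\<close> is about \<open>\<pi> k / 2\<close> (\<open>integral_H_bounds\<close>).

The relative error vanishes as \<open>k\<close> grows. In the sector the two parameters are comparable, so
all \<open>k\<close> intervals have comparable lengths, of order \<open>1/k\<close> (\<open>nodal_length_uniform\<close>), and by uniform
continuity the weights vary over such intervals by factors close to 1. Hence, writing \<open>A k\<close> for
\<open>\<pi> k / 2\<close> divided by the integral of \<open>H\<close>, the sequence \<open>A k\<close> converges to 1. The estimate
\<open>1 - A k = O(k\<^sup>\<delta>)\<close> follows, since the left-hand side is bounded and the exponent is positive.
\<close>

section \<open>Uniqueness and Sturm comparison\<close>

text \<open>Zeros of a nontrivial solution are simple because \<open>E = u\<^sup>2 + v\<^sup>2\<close> satisfies \<open>\<bar>E'\<bar> \<le> C E\<close>, so that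
\<open>E exp (- C x)\<close> decreases and \<open>E exp (C x)\<close> increases: if \<open>E\<close> vanishes at one point, it vanishes to the
right of it by the first fact and to the left of it by the second. The second derivative enters only
through the bound on \<open>g\<close>, so the piecewise linear right-hand side of the problem is covered.\<close>

lemma zero_Cauchy_data_imp_zero:
  fixes u v g :: "real \<Rightarrow> real"
  assumes du: "\<And>x. x \<in> {a..b} \<Longrightarrow> (u has_real_derivative v x) (at x within {a..b})"
    and cv: "continuous_on {a..b} v"
    and dv: "\<And>x. x \<in> {a<..<b} \<Longrightarrow> (v has_real_derivative g x) (at x)"
    and bound: "\<And>x. x \<in> {a<..<b} \<Longrightarrow> \<bar>g x\<bar> \<le> K * \<bar>u x\<bar>"
    and z: "z \<in> {a..b}" "u z = 0" "v z = 0"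
    and x: "x \<in> {a..b}"
  shows "u x = 0"
proof -
  define E where "E = (\<lambda>x. u x ^ 2 + v x ^ 2)"
  define C where "C = 1 + \<bar>K\<bar>"
  have cu: "continuous_on {a..b} u"
    using du DERIV_continuous_on by blast
  have cE: "continuous_on {a..b} (\<lambda>x. E x * exp (c * x))" for c
    unfolding E_def by (intro continuous_intros cu cv)
  have du': "(u has_real_derivative v y) (at y)" if "y \<in> {a<..<b}" for y
    using du[of y] that at_within_Icc_at[of a y b] by auto
  have dE: "((\<lambda>x. E x * exp (c * x)) has_real_derivative
      (2 * u y * v y + 2 * v y * g y + c * E y) * exp (c * y)) (at y)" if "y \<in> {a<..<b}" for y c
    unfolding E_def
    by (rule derivative_eq_intros du'[OF that] dv[OF that] refl)+ (simp add: algebra_simps)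
  have key: "\<bar>2 * u y * v y + 2 * v y * g y\<bar> \<le> C * E y" if "y \<in> {a<..<b}" for y
  proof -
    have "\<bar>g y\<bar> \<le> \<bar>K\<bar> * \<bar>u y\<bar>"
      using bound[OF that] by (meson abs_ge_self abs_ge_zero mult_right_mono order_trans)
    hence "\<bar>v y * g y\<bar> \<le> \<bar>K\<bar> * (\<bar>u y\<bar> * \<bar>v y\<bar>)"
      using mult_left_mono[of "\<bar>g y\<bar>" "\<bar>K\<bar> * \<bar>u y\<bar>" "\<bar>v y\<bar>"] by (simp add: abs_mult algebra_simps)
    moreover have "\<bar>u y * v y\<bar> = \<bar>u y\<bar> * \<bar>v y\<bar>" by (simp add: abs_mult)
    ultimately have "\<bar>u y * v y + v y * g y\<bar> \<le> C * (\<bar>u y\<bar> * \<bar>v y\<bar>)"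
      using abs_triangle_ineq[of "u y * v y" "v y * g y"] unfolding C_def distrib_right by linarith
    hence "\<bar>2 * (u y * v y + v y * g y)\<bar> \<le> C * (2 * (\<bar>u y\<bar> * \<bar>v y\<bar>))"
      by (subst abs_mult) simp
    hence "\<bar>2 * u y * v y + 2 * v y * g y\<bar> \<le> C * (2 * (\<bar>u y\<bar> * \<bar>v y\<bar>))"
      by (simp add: algebra_simps)
    also have "\<dots> \<le> C * E y"
      using sum_squares_bound[of "\<bar>u y\<bar>" "\<bar>v y\<bar>"]
      by (intro mult_left_mono) (auto simp: E_def C_def)
    finally show ?thesis .
  qed
  have Ez: "E z = 0" using z by (simp add: E_def)
  have "E x \<le> 0"
  proof (cases "z \<le> x")
    case True
    have "E x * exp (- C * x) \<le> E z * exp (- C * z)"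
    proof (rule DERIV_nonpos_imp_decreasing_open[OF True])
      fix y assume "z < y" "y < x"
      hence y: "y \<in> {a<..<b}" using z x by auto
      have "(2 * u y * v y + 2 * v y * g y + - C * E y) * exp (- C * y) \<le> 0"
        using key[OF y] by (intro mult_nonpos_nonneg) auto
      thus "\<exists>d. ((\<lambda>x. E x * exp (- C * x)) has_real_derivative d) (at y) \<and> d \<le> 0"
        using dE[OF y] by blast
    qed (rule continuous_on_subset[OF cE], use z x in auto)
    thus ?thesis using Ez by (simp add: mult_le_0_iff)
  next
    case False
    have "E x * exp (C * x) \<le> E z * exp (C * z)"
    proof (rule DERIV_nonneg_imp_increasing_open[where f = "\<lambda>x. E x * exp (C * x)"])
      fix y assume "x < y" "y < z"
      hence y: "y \<in> {a<..<b}" using z x by auto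
      have "0 \<le> (2 * u y * v y + 2 * v y * g y + C * E y) * exp (C * y)"
        using key[OF y] by (intro mult_nonneg_nonneg) auto
      thus "\<exists>d. ((\<lambda>x. E x * exp (C * x)) has_real_derivative d) (at y) \<and> 0 \<le> d"
        using dE[OF y] by blast
    qed (use False in simp, rule continuous_on_subset[OF cE], use z x in auto)
    thus ?thesis using Ez by (simp add: mult_le_0_iff)
  qed
  thus ?thesis by (simp add: E_def sum_power2_le_zero_iff)
qed

text \<open>The comparison function \<open>w = sin (\<omega> (x - a))\<close> solves \<open>w'' = - \<omega>\<^sup>2 w\<close> and vanishes at \<open>a\<close>. The
Wronskian \<open>u' w - u w'\<close> is then monotone wherever \<open>u\<close> and \<open>w\<close> are positive, with the direction
given by the sign of \<open>\<omega>\<^sup>2 - q\<close>.\<close>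

lemma has_derivative_Wronskian_sin:
  fixes u v :: "real \<Rightarrow> real"
  assumes "(u has_real_derivative v x) (at x)"
    and "(v has_real_derivative - (q * u x)) (at x)"
  shows "((\<lambda>x. v x * sin (\<omega> * (x - a)) - u x * (\<omega> * cos (\<omega> * (x - a))))
    has_real_derivative (\<omega>\<^sup>2 - q) * (u x * sin (\<omega> * (x - a)))) (at x)"
  by (rule derivative_eq_intros assms refl)+ (simp add: algebra_simps power2_eq_square)

text \<open>Sturm comparison from above. If the interval were longer than \<open>\<pi> / \<omega>\<close>, then at \<open>c = a + \<pi> / \<omega>\<close>,
the next zero of the sine, the decreasing Wronskian would equal \<open>\<omega> u(c) > 0\<close>, although it starts
at zero.\<close>

lemma nodal_length_le:
  fixes u v q :: "real \<Rightarrow> real"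
  assumes du: "\<And>x. x \<in> {a..b} \<Longrightarrow> (u has_real_derivative v x) (at x within {a..b})"
    and cv: "continuous_on {a..b} v"
    and dv: "\<And>x. x \<in> {a<..<b} \<Longrightarrow> (v has_real_derivative - (q x * u x)) (at x)"
    and pos: "\<And>x. x \<in> {a<..<b} \<Longrightarrow> 0 < u x"
    and ua: "u a = 0"
    and \<omega>: "0 < \<omega>" "\<And>x. x \<in> {a<..<b} \<Longrightarrow> \<omega>\<^sup>2 \<le> q x"
  shows "\<omega> * (b - a) \<le> pi"
proof (rule ccontr)
  define c where "c = a + pi / \<omega>"
  define W where "W = (\<lambda>x. v x * sin (\<omega> * (x - a)) - u x * (\<omega> * cos (\<omega> * (x - a))))"
  assume "\<not> \<omega> * (b - a) \<le> pi"
  hence c: "a < c" "c < b" using \<omega> pi_gt_zero by (auto simp: c_def field_simps)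
  have cu: "continuous_on {a..b} u"
    using du DERIV_continuous_on by blast
  have cW: "continuous_on {a..c} W"
    unfolding W_def using c
    by (intro continuous_intros continuous_on_subset[OF cu] continuous_on_subset[OF cv]) auto
  have "W c \<le> W a"
  proof (rule DERIV_nonpos_imp_decreasing_open[OF _ _ cW])
    fix x assume x: "a < x" "x < c"
    hence xab: "x \<in> {a<..<b}" using c by auto
    have "\<omega> * (x - a) < pi" using x \<omega> by (simp add: c_def field_simps)
    hence "0 \<le> sin (\<omega> * (x - a))" using x \<omega> by (intro sin_ge_zero) auto
    hence "(\<omega>\<^sup>2 - q x) * (u x * sin (\<omega> * (x - a))) \<le> 0"
      using \<omega>(2)[OF xab] pos[OF xab] by (intro mult_nonpos_nonneg) auto
    moreover have "(u has_real_derivative v x) (at x)"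
      using du[of x] xab at_within_Icc_at[of a x b] by auto
    ultimately show "\<exists>y. (W has_real_derivative y) (at x) \<and> y \<le> 0"
      using has_derivative_Wronskian_sin[of u v x "q x", OF _ dv[OF xab]] unfolding W_def by blast
  qed (use c in auto)
  moreover have "W a = 0" by (simp add: W_def ua)
  moreover have "W c = \<omega> * u c" using \<omega> by (simp add: W_def c_def)
  ultimately show False using pos[of c] c \<omega> by (simp add: mult_le_0_iff)
qed

text \<open>Sturm comparison from below. If the interval were shorter than \<open>\<pi> / \<omega>\<close>, the sine would still be
positive at \<open>b\<close>, and the increasing Wronskian would end at the negative value
\<open>u'(b) sin (\<omega> (b - a))\<close>.\<close>

lemma nodal_length_ge:
  fixes u v q :: "real \<Rightarrow> real"
  assumes "a < b"
    and du: "\<And>x. x \<in> {a..b} \<Longrightarrow> (u has_real_derivative v x) (at x within {a..b})"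
    and cv: "continuous_on {a..b} v"
    and dv: "\<And>x. x \<in> {a<..<b} \<Longrightarrow> (v has_real_derivative - (q x * u x)) (at x)"
    and pos: "\<And>x. x \<in> {a<..<b} \<Longrightarrow> 0 < u x"
    and ends: "u a = 0" "u b = 0" and "v b < 0"
    and \<omega>: "0 < \<omega>" "\<And>x. x \<in> {a<..<b} \<Longrightarrow> q x \<le> \<omega>\<^sup>2"
  shows "pi \<le> \<omega> * (b - a)"
proof (rule ccontr)
  define W where "W = (\<lambda>x. v x * sin (\<omega> * (x - a)) - u x * (\<omega> * cos (\<omega> * (x - a))))"
  assume short: "\<not> pi \<le> \<omega> * (b - a)"
  have cu: "continuous_on {a..b} u"
    using du DERIV_continuous_on by blast
  have cW: "continuous_on {a..b} W"
    unfolding W_def by (intro continuous_intros cu cv)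
  have sin_pos: "0 < sin (\<omega> * (x - a))" if "a < x" "x \<le> b" for x
  proof (rule sin_gt_zero)
    show "0 < \<omega> * (x - a)" using that \<omega> by simp
    have "\<omega> * (x - a) \<le> \<omega> * (b - a)" using that \<omega> by simp
    thus "\<omega> * (x - a) < pi" using short by linarith
  qed
  have "W a \<le> W b"
  proof (rule DERIV_nonneg_imp_increasing_open[OF _ _ cW])
    fix x assume x: "a < x" "x < b"
    hence xab: "x \<in> {a<..<b}" by auto
    have "0 \<le> (\<omega>\<^sup>2 - q x) * (u x * sin (\<omega> * (x - a)))"
      using \<omega>(2)[OF xab] pos[OF xab] sin_pos[of x] x by (intro mult_nonneg_nonneg) auto
    moreover have "(u has_real_derivative v x) (at x)"
      using du[of x] xab at_within_Icc_at[of a x b] by auto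
    ultimately show "\<exists>y. (W has_real_derivative y) (at x) \<and> 0 \<le> y"
      using has_derivative_Wronskian_sin[of u v x "q x", OF _ dv[OF xab]] unfolding W_def by blast
  qed (use \<open>a < b\<close> in auto)
  moreover have "W a = 0" by (simp add: W_def ends)
  moreover have "W b = v b * sin (\<omega> * (b - a))" by (simp add: W_def ends)
  ultimately show False
    using sin_pos[of b] \<open>a < b\<close> \<open>v b < 0\<close> by (simp add: zero_le_mult_iff)
qed

section \<open>Weights and grids\<close>

lemma weight_bounds:
  assumes "weight L m"
  obtains c M where "0 < c" "0 < M" "\<And>x. x \<in> {0..L} \<Longrightarrow> c \<le> m x" "\<And>x. x \<in> {0..L} \<Longrightarrow> m x \<le> M"
proof -
  obtain c where c: "0 < c" "\<And>x. x \<in> {0..L} \<Longrightarrow> c \<le> m x"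
    using assms unfolding weight_def by blast
  have "compact (m ` {0..L})"
    using assms unfolding weight_def by (intro compact_continuous_image) auto
  then obtain M where "\<forall>y\<in>m ` {0..L}. norm y \<le> M"
    using compact_imp_bounded bounded_iff by blast
  hence "\<And>x. x \<in> {0..L} \<Longrightarrow> \<bar>m x\<bar> \<le> M" by auto
  hence "m x \<le> max M 1" if "x \<in> {0..L}" for x
    using that by fastforce
  thus ?thesis using that[of c "max M 1"] c by simp
qed

text \<open>Since a weight is bounded away from zero, its uniform continuity becomes a bound on the ratio of
its values at nearby points. Ratios are the right scale here: the weights are multiplied by
parameters that tend to infinity.\<close>

lemma weight_ratio_le:
  assumes "weight L m" and "1 < R"
  obtains d where "0 < d"
    "\<And>x y. x \<in> {0..L} \<Longrightarrow> y \<in> {0..L} \<Longrightarrow> \<bar>x - y\<bar> \<le> d \<Longrightarrow> m x \<le> R * m y"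
proof -
  obtain c where c: "0 < c" "\<And>x. x \<in> {0..L} \<Longrightarrow> c \<le> m x"
    using assms unfolding weight_def by blast
  have "uniformly_continuous_on {0..L} m"
    using assms unfolding weight_def by (intro compact_uniformly_continuous) auto
  moreover have "0 < (R - 1) * c" using assms c by simp
  ultimately obtain d where d: "0 < d"
    "\<And>x y. x \<in> {0..L} \<Longrightarrow> y \<in> {0..L} \<Longrightarrow> dist y x < d \<Longrightarrow> dist (m y) (m x) < (R - 1) * c"
    unfolding uniformly_continuous_on_def by metis
  have "m x \<le> R * m y" if "x \<in> {0..L}" "y \<in> {0..L}" "\<bar>x - y\<bar> \<le> d / 2" for x y
  proof -
    have "\<bar>m x - m y\<bar> < (R - 1) * c"
      using d(2)[of y x] that d(1) by (simp add: dist_real_def)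
    also have "\<dots> \<le> (R - 1) * m y" using c(2)[OF that(2)] assms by simp
    finally show ?thesis by (simp add: algebra_simps)
  qed
  thus ?thesis using that[of "d / 2"] d(1) by simp
qed

lemma strict_grid_locate:
  fixes z :: "nat \<Rightarrow> real"
  assumes "z 0 \<le> x" "x < z N"
  shows "\<exists>i<N. z i \<le> x \<and> x < z (Suc i)"
  using assms
proof (induction N)
  case (Suc N)
  show ?case
  proof (cases "x < z N")
    case True
    thus ?thesis using Suc by (meson less_SucI)
  next
    case False
    thus ?thesis using Suc by (intro exI[of _ N]) auto
  qed
qed auto

text \<open>This ties the number of nodal domains, defined through connected components, to the zeros
\<open>z 0 < ... < z N\<close> of the solution.\<close>

lemma card_components_grid_complement:
  fixes z :: "nat \<Rightarrow> real"
  assumes mono: "\<And>i j. i < j \<Longrightarrow> j \<le> N \<Longrightarrow> z i < z j"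
    and S: "S = {x \<in> {z 0<..<z N}. x \<notin> z ` {..N}}"
  shows "card (components S) = N"
proof -
  define J where "J = (\<lambda>i. {z i<..<z (Suc i)})"
  have mono': "z i \<le> z j" if "i \<le> j" "j \<le> N" for i j
    using mono[of i j] that by (cases "i = j") auto
  have ne: "J i \<noteq> {}" if "i < N" for i
    using mono[of i "Suc i"] that unfolding J_def by simp
  have disj: "J i \<inter> J j = {}" if "i < j" "j < N" for i j
    using mono'[of "Suc i" j] that by (auto simp: J_def)
  have disj': "J i \<inter> J j = {}" if "i \<noteq> j" "i < N" "j < N" for i j
    using that disj[of i j] disj[of j i] by (cases i j rule: linorder_cases) auto
  have inj: "inj_on J {..<N}"
    by (rule inj_onI) (metis disj' ne inf.idem lessThan_iff)
  have comp: "components S = J ` {..<N}"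
  proof (rule components_open_unique)
    show "pairwise disjnt (J ` {..<N})"
      unfolding pairwise_def disjnt_def using disj' by (metis imageE lessThan_iff)
    show "\<Union> (J ` {..<N}) = S"
    proof (intro equalityI subsetI)
      fix x assume "x \<in> \<Union> (J ` {..<N})"
      then obtain i where i: "i < N" "z i < x" "x < z (Suc i)" by (auto simp: J_def)
      have "x \<noteq> z j" if "j \<le> N" for j
        using i mono'[of j i] mono'[of "Suc i" j] that by (cases "j \<le> i") auto
      moreover have "z 0 \<le> z i" "z (Suc i) \<le> z N"
        using i mono'[of 0 i] mono'[of "Suc i" N] by auto
      ultimately show "x \<in> S" using i by (auto simp: S)
    next
      fix x assume x: "x \<in> S"
      then obtain i where i: "i < N" "z i \<le> x" "x < z (Suc i)"
        using strict_grid_locate[of z x N] by (auto simp: S)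
      have "z i \<noteq> x" using x i by (auto simp: S)
      thus "x \<in> \<Union> (J ` {..<N})" using i by (force simp: J_def)
    qed
  qed (use ne in \<open>auto simp: J_def\<close>)
  show "card (components S) = N"
    using comp card_image[OF inj] by simp
qed

section \<open>Zeros and nodal intervals of a solution\<close>

locale nontrivial_fucik_solution =
  fixes L :: real and m n :: "real \<Rightarrow> real" and \<alpha> \<beta> :: real and u v :: "real \<Rightarrow> real"
  assumes L: "0 < L" and weights: "weight L m" "weight L n"
    and coeffs: "0 < \<alpha>" "0 < \<beta>"
    and du: "x \<in> {0..L} \<Longrightarrow> (u has_real_derivative v x) (at x within {0..L})"
    and cv: "continuous_on {0..L} v"
    and dv: "x \<in> {0<..<L} \<Longrightarrow> (v has_real_derivative
               - (\<alpha> * m x * pos_part (u x) - \<beta> * n x * neg_part (u x))) (at x)"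
    and boundary: "u 0 = 0" "u L = 0"
    and nontrivial: "\<exists>x\<in>{0..L}. u x \<noteq> 0"
begin

lemma cu: "continuous_on {0..L} u"
  using du DERIV_continuous_on by blast

lemma simple_zero:
  assumes "z \<in> {0..L}" "u z = 0"
  shows "v z \<noteq> 0"
proof
  assume "v z = 0"
  obtain c M where M: "0 < c" "0 < M" "\<And>x. x \<in> {0..L} \<Longrightarrow> c \<le> m x" "\<And>x. x \<in> {0..L} \<Longrightarrow> m x \<le> M"
    using weight_bounds[OF weights(1)] by metis
  obtain c' M' where M': "0 < c'" "0 < M'" "\<And>x. x \<in> {0..L} \<Longrightarrow> c' \<le> n x" "\<And>x. x \<in> {0..L} \<Longrightarrow> n x \<le> M'"
    using weight_bounds[OF weights(2)] by metis
  have "\<bar>- (\<alpha> * m x * pos_part (u x) - \<beta> * n x * neg_part (u x))\<bar> \<le> (\<alpha> * M + \<beta> * M') * \<bar>u x\<bar>"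
    if "x \<in> {0<..<L}" for x
  proof -
    have x: "x \<in> {0..L}" using that by auto
    have "0 \<le> \<alpha> * m x" "\<alpha> * m x \<le> \<alpha> * M + \<beta> * M'"
      using M(3)[OF x] M(4)[OF x] M M' coeffs by (auto intro: add_increasing2)
    moreover have "0 \<le> \<beta> * n x" "\<beta> * n x \<le> \<alpha> * M + \<beta> * M'"
      using M'(3)[OF x] M'(4)[OF x] M M' coeffs by (auto intro: add_increasing)
    ultimately show ?thesis
      by (cases "0 \<le> u x") (auto simp: pos_part_def neg_part_def abs_mult intro: mult_right_mono)
  qed
  hence "u x = 0" if "x \<in> {0..L}" for x
    using zero_Cauchy_data_imp_zero[OF du cv dv _ assms \<open>v z = 0\<close> that] by blast
  thus False using nontrivial by blast
qed

text \<open>At an accumulation point of zeros both \<open>u\<close> and its derivative would vanish, the latter as the limit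
of difference quotients between zeros; this contradicts simplicity.\<close>

lemma finite_zeros: "finite {x \<in> {0..L}. u x = 0}"
proof (rule ccontr)
  let ?Z = "{x \<in> {0..L}. u x = 0}"
  assume "infinite ?Z"
  hence "\<exists>z\<in>{0..L}. z islimpt ?Z"
    by (intro Heine_Borel_imp_Bolzano_Weierstrass) auto
  then obtain z where z: "z \<in> {0..L}" "z islimpt ?Z" by (elim bexE)
  have "closed ?Z"
    using continuous_closed_preimage_constant[OF cu] by auto
  hence "z \<in> ?Z" using z(2) unfolding closed_limpt by (elim allE impE)
  hence "u z = 0" by simp
  have "((\<lambda>y. (u y - u z) / (y - z)) \<longlongrightarrow> v z) (at z within {0..L})"
    using du[OF z(1)] by (simp add: has_field_derivative_iff)
  hence "((\<lambda>y. (u y - u z) / (y - z)) \<longlongrightarrow> v z) (at z within ?Z)"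
    by (rule tendsto_within_subset) auto
  moreover have "\<forall>\<^sub>F y in at z within ?Z. (u y - u z) / (y - z) = 0"
    using \<open>u z = 0\<close> by (auto simp: eventually_at_filter)
  ultimately have "((\<lambda>y. 0) \<longlongrightarrow> v z) (at z within ?Z)"
    by (rule Lim_transform_eventually)
  moreover have "at z within ?Z \<noteq> bot"
    using z(2) by (simp add: trivial_limit_within)
  ultimately have "v z = 0"
    by (intro tendsto_unique[OF _ _ tendsto_const])
  thus False using simple_zero[OF z(1) \<open>u z = 0\<close>] by blast
qed

text \<open>The sign \<open>s\<close> is a parameter, so that \<open>s u\<close> is positive on the interval and positive and negative
nodal intervals are treated by the same argument.\<close>

definition nodal :: "real \<Rightarrow> real \<Rightarrow> real \<Rightarrow> bool" where
  "nodal s a b \<longleftrightarrow> s \<in> {1, -1} \<and> 0 \<le> a \<and> a < b \<and> b \<le> L \<and> u a = 0 \<and> u b = 0 \<and>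
     (\<forall>x\<in>{a<..<b}. 0 < s * u x)"

lemma nodal_sign_exists:
  assumes "0 \<le> a" "a < b" "b \<le> L" "u a = 0" "u b = 0" "\<And>x. x \<in> {a<..<b} \<Longrightarrow> u x \<noteq> 0"
  shows "\<exists>s. nodal s a b"
proof -
  have "connected (u ` {a<..<b})"
    using assms by (intro connected_continuous_image continuous_on_subset[OF cu]) auto
  hence iv: "is_interval (u ` {a<..<b})" using is_interval_connected_1 by blast
  have "(\<forall>x\<in>{a<..<b}. 0 < u x) \<or> (\<forall>x\<in>{a<..<b}. u x < 0)"
  proof (rule ccontr)
    assume "\<not> ?thesis"
    then obtain x y where "x \<in> {a<..<b}" "y \<in> {a<..<b}" "u x \<le> 0" "0 \<le> u y"
      by (auto simp: not_less)
    hence "0 \<in> u ` {a<..<b}"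
      using iv unfolding is_interval_1 by (meson imageI)
    thus False using assms(6) by auto
  qed
  thus ?thesis
  proof
    assume "\<forall>x\<in>{a<..<b}. 0 < u x"
    thus ?thesis using assms by (intro exI[of _ 1]) (auto simp: nodal_def)
  next
    assume "\<forall>x\<in>{a<..<b}. u x < 0"
    thus ?thesis using assms by (intro exI[of _ "-1"]) (auto simp: nodal_def)
  qed
qed

text \<open>The inequalities are strict because the end points are simple zeros. They decide the sign of the
neighbouring intervals and supply the negative end slope that the lower Sturm bound needs.\<close>

lemma nodal_slopes:
  assumes "nodal s a b"
  shows "0 < s * v a" and "s * v b < 0"
proof -
  have ab: "s \<in> {1, -1}" "a \<in> {0..L}" "b \<in> {0..L}" "a < b" "u a = 0" "u b = 0"
    and pos: "\<And>x. a < x \<Longrightarrow> x < b \<Longrightarrow> 0 < s * u x"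
    using assms by (auto simp: nodal_def)
  have dsu: "((\<lambda>x. s * u x) has_real_derivative s * v x) (at x within {0..L})" if "x \<in> {0..L}" for x
    by (rule DERIV_cmult[OF du[OF that]])
  have "s * v a \<noteq> 0" "s * v b \<noteq> 0"
    using simple_zero ab by auto
  moreover have "\<not> s * v a < 0"
  proof
    assume "s * v a < 0"
    from has_real_derivative_neg_dec_right[OF dsu[OF ab(2)] this]
    obtain d where d: "0 < d" "\<And>h. 0 < h \<Longrightarrow> a + h \<in> {0..L} \<Longrightarrow> h < d \<Longrightarrow> s * u (a + h) < s * u a"
      by blast
    define h where "h = min d (b - a) / 2"
    have h: "0 < h" "h < d" "h < b - a" using d(1) ab by (auto simp: h_def)
    show False using d(2)[of h] pos[of "a + h"] h ab by auto
  qed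
  moreover have "\<not> 0 < s * v b"
  proof
    assume "0 < s * v b"
    from has_real_derivative_pos_inc_left[OF dsu[OF ab(3)] this]
    obtain d where d: "0 < d" "\<And>h. 0 < h \<Longrightarrow> b - h \<in> {0..L} \<Longrightarrow> h < d \<Longrightarrow> s * u (b - h) < s * u b"
      by blast
    define h where "h = min d (b - a) / 2"
    have h: "0 < h" "h < d" "h < b - a" using d(1) ab by (auto simp: h_def)
    show False using d(2)[of h] pos[of "b - h"] h ab by auto
  qed
  ultimately show "0 < s * v a" "s * v b < 0" by linarith+
qed

lemma nodal_signs_alternate:
  assumes "nodal s a b" "nodal t b c"
  shows "t = - s"
  using nodal_slopes(2)[OF assms(1)] nodal_slopes(1)[OF assms(2)] assms
  by (auto simp: nodal_def)

text \<open>The coefficient of the linear equation \<open>w'' = - q w\<close> that \<open>w = s u\<close> solves on a nodal interval of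
sign \<open>s\<close>.\<close>

definition coeff :: "real \<Rightarrow> real \<Rightarrow> real" where
  "coeff s x = (if s = 1 then \<alpha> * m x else \<beta> * n x)"

lemma nodal_equation:
  assumes "nodal s a b"
  shows "x \<in> {a..b} \<Longrightarrow> ((\<lambda>x. s * u x) has_real_derivative s * v x) (at x within {a..b})"
    and "continuous_on {a..b} (\<lambda>x. s * v x)"
    and "x \<in> {a<..<b} \<Longrightarrow> ((\<lambda>x. s * v x) has_real_derivative - (coeff s x * (s * u x))) (at x)"
proof -
  have ab: "{a..b} \<subseteq> {0..L}" "{a<..<b} \<subseteq> {0<..<L}"
    using assms by (auto simp: nodal_def)
  show "((\<lambda>x. s * u x) has_real_derivative s * v x) (at x within {a..b})" if "x \<in> {a..b}"
    using du[of x] ab(1) that by (intro DERIV_cmult) (auto intro: DERIV_subset)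
  show "continuous_on {a..b} (\<lambda>x. s * v x)"
    by (intro continuous_intros continuous_on_subset[OF cv ab(1)])
  show "((\<lambda>x. s * v x) has_real_derivative - (coeff s x * (s * u x))) (at x)" if "x \<in> {a<..<b}"
  proof -
    have "0 < s * u x" "s = 1 \<or> s = -1" using assms that by (auto simp: nodal_def)
    hence "s * - (\<alpha> * m x * pos_part (u x) - \<beta> * n x * neg_part (u x)) = - (coeff s x * (s * u x))"
      by (auto simp: pos_part_def neg_part_def coeff_def)
    thus ?thesis using DERIV_cmult[OF dv, of x s] ab(2) that by auto
  qed
qed

lemma nodal_interval_length:
  assumes "nodal s a b" "0 < \<omega>"
  shows "(\<And>x. x \<in> {a<..<b} \<Longrightarrow> \<omega>\<^sup>2 \<le> coeff s x) \<Longrightarrow> \<omega> * (b - a) \<le> pi"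
    and "(\<And>x. x \<in> {a<..<b} \<Longrightarrow> coeff s x \<le> \<omega>\<^sup>2) \<Longrightarrow> pi \<le> \<omega> * (b - a)"
proof -
  have ab: "a < b" "s * u a = 0" "s * u b = 0" "\<And>x. x \<in> {a<..<b} \<Longrightarrow> 0 < s * u x"
    using assms by (auto simp: nodal_def)
  show "\<omega> * (b - a) \<le> pi" if "\<And>x. x \<in> {a<..<b} \<Longrightarrow> \<omega>\<^sup>2 \<le> coeff s x"
    by (rule nodal_length_le[OF nodal_equation[OF assms(1)] ab(4) ab(2) assms(2) that])
  show "pi \<le> \<omega> * (b - a)" if "\<And>x. x \<in> {a<..<b} \<Longrightarrow> coeff s x \<le> \<omega>\<^sup>2"
    by (rule nodal_length_ge[OF ab(1) nodal_equation[OF assms(1)] ab(4) ab(2,3)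
          nodal_slopes(2)[OF assms(1)] assms(2) that])
qed

text \<open>The grid is the increasing enumeration of all zeros, which exists since there are finitely many. The
gaps between consecutive zeros are precisely the nodal domains, hence the number of grid steps.\<close>

lemma nodal_grid:
  obtains z :: "nat \<Rightarrow> real" where "z 0 = 0" "z (card (nodal_domains L u)) = L"
    "\<And>i. i < card (nodal_domains L u) \<Longrightarrow> \<exists>s. nodal s (z i) (z (Suc i))"
proof -
  define Z where "Z = {x \<in> {0..L}. u x = 0}"
  define xs where "xs = sorted_list_of_set Z"
  define z where "z = (\<lambda>i. xs ! i)"
  define N where "N = length xs - 1"
  have set_xs: "set xs = Z" and sorted: "sorted_wrt (<) xs"
    using finite_zeros by (auto simp: xs_def Z_def)
  have ends: "0 \<in> Z" "L \<in> Z" using L boundary by (auto simp: Z_def)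
  have len: "length xs = Suc N"
    using ends set_xs by (cases xs) (auto simp: N_def)
  have mono: "z i < z j" if "i < j" "j \<le> N" for i j
    using sorted_wrt_nth_less[OF sorted] that len by (simp add: z_def)
  have mono': "z i \<le> z j" if "i \<le> j" "j \<le> N" for i j
    using mono[of i j] that by (cases "i = j") auto
  have img: "z ` {..N} = Z"
    using set_xs len by (auto simp: z_def set_conv_nth less_Suc_eq_le)
  have zZ: "z i \<in> Z" if "i \<le> N" for i using img that by blast
  have z0: "z 0 = 0"
  proof -
    obtain j where "j \<le> N" "z j = 0" using ends(1) img by (metis atMost_iff imageE)
    thus ?thesis using mono'[of 0 j] zZ[of 0] by (auto simp: Z_def)
  qed
  have zN: "z N = L"
  proof -
    obtain j where "j \<le> N" "z j = L" using ends(2) img by (metis atMost_iff imageE)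
    thus ?thesis using mono'[of j N] zZ[of N] by (auto simp: Z_def)
  qed
  have S: "{x \<in> {0<..<L}. u x \<noteq> 0} = {x \<in> {z 0<..<z N}. x \<notin> z ` {..N}}"
    by (auto simp: z0 zN img Z_def)
  have card: "card (nodal_domains L u) = N"
    unfolding nodal_domains_def by (rule card_components_grid_complement[OF mono S])
  have "\<exists>s. nodal s (z i) (z (Suc i))" if "i < N" for i
  proof (rule nodal_sign_exists)
    show "z i < z (Suc i)" using mono that by simp
    show "0 \<le> z i" "z (Suc i) \<le> L" "u (z i) = 0" "u (z (Suc i)) = 0"
      using zZ[of i] zZ[of "Suc i"] that by (auto simp: Z_def)
    fix x assume x: "x \<in> {z i<..<z (Suc i)}"
    show "u x \<noteq> 0"
    proof
      assume "u x = 0"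
      hence "x \<in> Z" using x zZ[of i] zZ[of "Suc i"] that by (auto simp: Z_def)
      then obtain j where "j \<le> N" "z j = x" using img by (metis atMost_iff imageE)
      thus False using x mono'[of j i] mono'[of "Suc i" j] that by (cases "j \<le> i") auto
    qed
  qed
  thus ?thesis using that[of z] z0 zN card by simp
qed

end

section \<open>The integral of the harmonic weight\<close>

text \<open>The reason why the harmonic combination of the two weights appears: two neighbouring intervals have
lengths close to \<open>\<pi> / P\<close> and \<open>\<pi> / Q\<close>, where \<open>P\<close> and \<open>Q\<close> are the two frequencies, so the
constant \<open>(1/P + 1/Q)\<^sup>-\<^sup>1\<close> integrates to about \<open>\<pi>\<close> over their union.\<close>

lemma harmonic_sum_bounds:
  fixes P Q l1 l2 c1 c2 :: real
  assumes "0 < P" "0 < Q" "c1 \<le> P * l1" "P * l1 \<le> c2" "c1 \<le> Q * l2" "Q * l2 \<le> c2"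
  shows "c1 \<le> inverse (1 / P + 1 / Q) * (l1 + l2)" and "inverse (1 / P + 1 / Q) * (l1 + l2) \<le> c2"
proof -
  have pos: "0 < 1 / P + 1 / Q" using assms by (simp add: add_pos_pos)
  have "c1 / P \<le> l1" "l1 \<le> c2 / P" "c1 / Q \<le> l2" "l2 \<le> c2 / Q"
    using assms by (simp_all add: field_simps)
  hence "c1 * (1 / P + 1 / Q) \<le> l1 + l2" "l1 + l2 \<le> c2 * (1 / P + 1 / Q)"
    by (simp_all add: algebra_simps)
  thus "c1 \<le> inverse (1 / P + 1 / Q) * (l1 + l2)" "inverse (1 / P + 1 / Q) * (l1 + l2) \<le> c2"
    using pos by (simp_all add: inverse_eq_divide pos_le_divide_eq pos_divide_le_eq)
qed

lemma integral_bounds_by_length: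
  fixes f :: "real \<Rightarrow> real"
  assumes "a < b" and cont: "continuous_on {a..b} f"
    and bounds: "\<And>x. x \<in> {a..b} \<Longrightarrow> c1 \<le> f x * (b - a)" "\<And>x. x \<in> {a..b} \<Longrightarrow> f x * (b - a) \<le> c2"
  shows "c1 \<le> integral {a..b} f" and "integral {a..b} f \<le> c2"
proof -
  have int: "f integrable_on {a..b}" using cont integrable_continuous_real by blast
  have "integral {a..b} (\<lambda>x. c1 / (b - a)) \<le> integral {a..b} f"
    using bounds(1) \<open>a < b\<close> by (intro integral_le int) (auto simp: field_simps)
  thus "c1 \<le> integral {a..b} f" using \<open>a < b\<close> by simp
  have "integral {a..b} f \<le> integral {a..b} (\<lambda>x. c2 / (b - a))"
    using bounds(2) \<open>a < b\<close> by (intro integral_le int) (auto simp: field_simps)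
  thus "integral {a..b} f \<le> c2" using \<open>a < b\<close> by simp
qed

lemma integral_sum_over_grid:
  fixes f :: "real \<Rightarrow> real" and z :: "nat \<Rightarrow> real"
  assumes "\<And>i. i < N \<Longrightarrow> z i \<le> z (Suc i)" and "f integrable_on {z 0..z N}"
  shows "(\<Sum>i<N. integral {z i..z (Suc i)} f) = integral {z 0..z N} f"
  using assms
proof (induction N)
  case (Suc N)
  have step: "z N \<le> z (Suc N)" using Suc.prems(1) by simp
  have "z 0 \<le> z i" if "i \<le> Suc N" for i
    using that by (induction i) (use Suc.prems(1) in \<open>auto intro: order.trans\<close>)
  hence "z 0 \<le> z N" by simp
  moreover have "f integrable_on {z 0..z N}"
    using Suc.prems(2) step by (auto intro: integrable_on_subinterval)
  ultimately have "(\<Sum>i<N. integral {z i..z (Suc i)} f) = integral {z 0..z N} f"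
    using Suc by simp
  thus ?case
    using Henstock_Kurzweil_Integration.integral_combine[OF \<open>z 0 \<le> z N\<close> step Suc.prems(2)]
      \<open>z 0 \<le> z N\<close> step by simp
qed auto

text \<open>Only pairs of neighbouring nodal intervals have a well controlled integral. Summing over overlapping
pairs instead of disjoint ones avoids a distinction by the parity of the number of intervals.\<close>

lemma sum_of_adjacent_pairs:
  fixes J :: "nat \<Rightarrow> real"
  shows "(\<Sum>i<K. J i + J (Suc i)) = 2 * (\<Sum>i<Suc K. J i) - J 0 - J K"
  by (induction K) auto

context nontrivial_fucik_solution
begin

abbreviation H :: "real \<Rightarrow> real" where
  "H \<equiv> harmonic_weight (\<lambda>x. \<alpha> * m x) (\<lambda>x. \<beta> * n x)"

lemma coeff_pos: "x \<in> {0..L} \<Longrightarrow> 0 < coeff s x"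
  using weights coeffs unfolding weight_def coeff_def by fastforce

lemma H_eq:
  assumes "x \<in> {0..L}" "s \<in> {1, -1}"
  shows "H x = inverse (1 / sqrt (coeff s x) + 1 / sqrt (coeff (- s) x))"
proof -
  have "0 < \<alpha> * m x" "0 < \<beta> * n x"
    using coeff_pos[OF assms(1), of 1] coeff_pos[OF assms(1), of "-1"] by (auto simp: coeff_def)
  hence "(\<alpha> * m x) powr (-1/2) = 1 / sqrt (\<alpha> * m x)" "(\<beta> * n x) powr (-1/2) = 1 / sqrt (\<beta> * n x)"
    by (simp_all add: powr_minus powr_half_sqrt inverse_eq_divide)
  thus ?thesis using assms(2) by (auto simp: harmonic_weight_def coeff_def add.commute)
qed

lemma H_continuous: "continuous_on {0..L} H"
proof -
  have pos: "0 < \<alpha> * m x" "0 < \<beta> * n x" if "x \<in> {0..L}" for x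
    using coeff_pos[OF that, of 1] coeff_pos[OF that, of "-1"] by (auto simp: coeff_def)
  have cont: "continuous_on {0..L} (\<lambda>x. \<alpha> * m x)" "continuous_on {0..L} (\<lambda>x. \<beta> * n x)"
    using weights by (auto simp: weight_def intro: continuous_on_mult_left)
  have nonzero: "\<forall>x\<in>{0..L}. (\<alpha> * m x) powr (-1/2) + (\<beta> * n x) powr (-1/2) \<noteq> 0"
  proof
    fix x assume "x \<in> {0..L}"
    hence "0 < (\<alpha> * m x) powr (-1/2)" "0 < (\<beta> * n x) powr (-1/2)"
      using pos[of x] by auto
    thus "(\<alpha> * m x) powr (-1/2) + (\<beta> * n x) powr (-1/2) \<noteq> 0" by linarith
  qed
  have "\<forall>x\<in>{0..L}. \<alpha> * m x \<noteq> 0" "\<forall>x\<in>{0..L}. \<beta> * n x \<noteq> 0"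
    using pos by (metis less_irrefl)+
  thus ?thesis
    unfolding harmonic_weight_def
    by (intro continuous_on_inverse continuous_on_add continuous_on_powr cont continuous_on_const nonzero)
qed

text \<open>Comparison with the frequency frozen at one nearby point \<open>x\<close>. The point may lie outside the interval,
because it is chosen anywhere in a pair of neighbouring intervals.\<close>

lemma nodal_length_weighted:
  assumes nodal: "nodal s a b" and "0 < r" and "0 < coeff s x"
    and near: "\<And>y. y \<in> {a<..<b} \<Longrightarrow> coeff s x \<le> r\<^sup>2 * coeff s y"
      "\<And>y. y \<in> {a<..<b} \<Longrightarrow> coeff s y \<le> r\<^sup>2 * coeff s x"
  shows "pi / r \<le> sqrt (coeff s x) * (b - a)" and "sqrt (coeff s x) * (b - a) \<le> pi * r"
proof -
  have "sqrt (coeff s x) / r * (b - a) \<le> pi"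
    using assms by (intro nodal_interval_length(1)[OF nodal])
      (auto simp: power_divide field_simps)
  thus "sqrt (coeff s x) * (b - a) \<le> pi * r" using \<open>0 < r\<close> by (simp add: field_simps)
  have "pi \<le> sqrt (coeff s x) * r * (b - a)"
    using assms by (intro nodal_interval_length(2)[OF nodal])
      (auto simp: power_mult_distrib mult.commute)
  thus "pi / r \<le> sqrt (coeff s x) * (b - a)" using \<open>0 < r\<close> by (simp add: field_simps)
qed

text \<open>All nodal intervals are comparably long. Each is at least \<open>\<pi> / sqrt (\<nu> M)\<close> long, with \<open>\<nu>\<close> the larger
parameter; since they fill \<open>[0, L]\<close>, this forces \<open>\<nu>\<close> to be at least of order \<open>k\<^sup>2\<close>. The smaller
parameter \<open>\<mu>\<close> is comparable to \<open>\<nu>\<close>, and each interval is at most \<open>\<pi> / sqrt (\<mu> c)\<close> long, which is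
therefore of order \<open>1/k\<close>.\<close>

lemma nodal_length_uniform:
  assumes bounds: "0 < c" "\<And>x. x \<in> {0..L} \<Longrightarrow> c \<le> m x \<and> m x \<le> M \<and> c \<le> n x \<and> n x \<le> M"
    and T: "0 < T" "\<alpha> \<le> T * \<beta>" "\<beta> \<le> T * \<alpha>"
    and nodal: "nodal s a b"
  shows "real (card (nodal_domains L u)) * (b - a) \<le> L * sqrt (T * M / c)"
proof -
  define \<mu> where "\<mu> = min \<alpha> \<beta>"
  define \<nu> where "\<nu> = max \<alpha> \<beta>"
  define k where "k = card (nodal_domains L u)"
  have \<mu>: "0 < \<mu>" "0 < \<nu>"
    using coeffs by (auto simp: \<mu>_def \<nu>_def)
  have \<nu>\<mu>: "\<nu> \<le> T * \<mu>"
    using coeffs T by (cases "\<alpha> \<le> \<beta>") (auto simp: \<mu>_def \<nu>_def min_def max_def)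
  have M: "0 < M" using bounds(1) bounds(2)[of 0] L by simp
  have coeff: "\<mu> * c \<le> coeff s x" "coeff s x \<le> \<nu> * M" if "x \<in> {0..L}" for s x
    using bounds(1) bounds(2)[OF that] \<mu> M
    by (auto simp: coeff_def \<mu>_def \<nu>_def intro!: mult_mono)
  have sub: "x \<in> {0..L}" if "nodal s a b" "x \<in> {a<..<b}" for s a b x
    using that by (auto simp: nodal_def)
  have upper: "sqrt (\<mu> * c) * (b - a) \<le> pi"
    using \<mu> bounds(1) coeff(1) sub[OF nodal] by (intro nodal_interval_length(1)[OF nodal]) auto
  have lower: "pi \<le> sqrt (\<nu> * M) * (b - a)" if "nodal s a b" for s a b
    using \<mu> M coeff(2) sub[OF that] by (intro nodal_interval_length(2)[OF that]) auto
  obtain z where z: "z 0 = 0" "z k = L" "\<And>i. i < k \<Longrightarrow> \<exists>s. nodal s (z i) (z (Suc i))"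
    using nodal_grid unfolding k_def by metis
  have step: "pi \<le> sqrt (\<nu> * M) * (z (Suc i) - z i)" if i: "i < k" for i
  proof -
    obtain s where "nodal s (z i) (z (Suc i))" using z(3)[OF i] by (elim exE)
    thus ?thesis by (rule lower)
  qed
  have "k * pi = (\<Sum>i<k. pi)" by simp
  also have "\<dots> \<le> (\<Sum>i<k. sqrt (\<nu> * M) * (z (Suc i) - z i))"
    using step by (intro sum_mono) simp
  also have "\<dots> = sqrt (\<nu> * M) * L"
    unfolding sum_distrib_left[symmetric] by (simp add: sum_lessThan_telescope z)
  also have "\<dots> \<le> sqrt (T * \<mu> * M) * L"
    using \<nu>\<mu> M L by simp
  also have "T * \<mu> * M = (\<mu> * c) * (T * M / c)" using bounds(1) by simp
  finally have "k * pi \<le> sqrt (\<mu> * c) * (L * sqrt (T * M / c))"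
    by (simp only: real_sqrt_mult mult_ac)
  moreover have "sqrt (\<mu> * c) * (k * (b - a)) \<le> k * pi"
    using mult_left_mono[OF upper, of "real k"] by (simp add: mult_ac)
  ultimately have "sqrt (\<mu> * c) * (k * (b - a)) \<le> sqrt (\<mu> * c) * (L * sqrt (T * M / c))"
    by linarith
  thus ?thesis using \<mu> bounds(1) by (simp add: k_def)
qed

text \<open>Signs alternate, so a pair of neighbouring intervals sees one interval of each frequency and
contributes about \<open>\<pi>\<close>. A single interval contributes at most about \<open>\<pi>\<close>, since the harmonic weight
lies below the frequency of that interval; this controls the two end intervals, which occur in
only one pair.\<close>

lemma integral_H_bounds:
  assumes r: "0 < r"
    and slow: "\<And>x y. x \<in> {0..L} \<Longrightarrow> y \<in> {0..L} \<Longrightarrow> \<bar>x - y\<bar> \<le> d \<Longrightarrow>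
        m x \<le> r\<^sup>2 * m y \<and> n x \<le> r\<^sup>2 * n y"
    and short: "\<And>s a b. nodal s a b \<Longrightarrow> b - a \<le> d / 2"
    and card: "card (nodal_domains L u) = Suc K"
  shows "real K * (pi / r) \<le> 2 * integral {0..L} H"
    and "2 * integral {0..L} H \<le> (real K + 2) * (pi * r)"
proof -
  have slow': "coeff s x \<le> r\<^sup>2 * coeff s y" if "x \<in> {0..L}" "y \<in> {0..L}" "\<bar>x - y\<bar> \<le> d" for s x y
    using slow[OF that] coeffs by (auto simp: coeff_def algebra_simps)
  have len: "pi / r \<le> sqrt (coeff s x) * (b - a)" "sqrt (coeff s x) * (b - a) \<le> pi * r"
    if "nodal s a b" "x \<in> {0..L}" "\<And>y. y \<in> {a<..<b} \<Longrightarrow> \<bar>x - y\<bar> \<le> d" for s a b x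
  proof -
    have sub: "y \<in> {0..L}" if "y \<in> {a<..<b}" for y
      using that \<open>nodal s a b\<close> by (auto simp: nodal_def)
    show "pi / r \<le> sqrt (coeff s x) * (b - a)" "sqrt (coeff s x) * (b - a) \<le> pi * r"
      using that sub
      by (auto intro!: nodal_length_weighted[OF that(1) r coeff_pos[OF that(2)]] slow'
          simp: abs_minus_commute)
  qed
  \<comment> \<open>A pair is at most \<open>d\<close> long, so at each of its points \<open>x\<close> both frequencies may be frozen.\<close>
  have pair: "pi / r \<le> integral {a..c} H" "integral {a..c} H \<le> pi * r"
    if ab: "nodal s a b" and bc: "nodal t b c" for s t a b c
  proof -
    have t: "t = - s" by (rule nodal_signs_alternate[OF ab bc])
    have abc: "s \<in> {1, -1}" "0 \<le> a" "a < b" "b < c" "c \<le> L" "c - a \<le> d"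
      using ab bc short[OF ab] short[OF bc] by (auto simp: nodal_def)
    have "pi / r \<le> H x * (c - a) \<and> H x * (c - a) \<le> pi * r" if "x \<in> {a..c}" for x
    proof -
      have x: "x \<in> {0..L}" using that abc by auto
      have near: "\<bar>x - y\<bar> \<le> d" if "y \<in> {a..c}" for y using that \<open>x \<in> {a..c}\<close> abc by auto
      have l1: "pi / r \<le> sqrt (coeff s x) * (b - a)" "sqrt (coeff s x) * (b - a) \<le> pi * r"
        using abc by (auto intro!: len[OF ab x] near)
      have l2: "pi / r \<le> sqrt (coeff (- s) x) * (c - b)" "sqrt (coeff (- s) x) * (c - b) \<le> pi * r"
        using abc by (auto intro!: len[OF bc[unfolded t] x] near)
      show ?thesis
        using harmonic_sum_bounds[OF _ _ l1 l2] coeff_pos[OF x] H_eq[OF x abc(1)] by simp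
    qed
    thus "pi / r \<le> integral {a..c} H" "integral {a..c} H \<le> pi * r"
      using integral_bounds_by_length[of a c H "pi / r" "pi * r"] abc
        continuous_on_subset[OF H_continuous, of "{a..c}"] by auto
  qed
  have single: "0 \<le> integral {a..b} H" "integral {a..b} H \<le> pi * r" if ab: "nodal s a b" for s a b
  proof -
    have abc: "s \<in> {1, -1}" "0 \<le> a" "a < b" "b \<le> L" "b - a \<le> d / 2"
      using ab short[OF ab] by (auto simp: nodal_def)
    have "0 \<le> H x * (b - a) \<and> H x * (b - a) \<le> pi * r" if "x \<in> {a..b}" for x
    proof -
      have x: "x \<in> {0..L}" using that abc by auto
      define P where "P = sqrt (coeff s x)"
      define Q where "Q = sqrt (coeff (- s) x)"
      have PQ: "0 < P" "0 < Q" using coeff_pos[OF x] by (auto simp: P_def Q_def)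
      have H: "H x = inverse (1 / P + 1 / Q)"
        using H_eq[OF x abc(1)] by (simp add: P_def Q_def)
      have "inverse (1 / P + 1 / Q) \<le> inverse (1 / P)"
        using PQ by (intro le_imp_inverse_le) auto
      hence "H x \<le> P" using H by simp
      hence "H x * (b - a) \<le> P * (b - a)" using abc by simp
      also have "\<dots> \<le> pi * r"
        unfolding P_def using abc that by (intro len(2)[OF ab x]) auto
      finally show ?thesis using H PQ abc by simp
    qed
    thus "0 \<le> integral {a..b} H" "integral {a..b} H \<le> pi * r"
      using integral_bounds_by_length[of a b H 0 "pi * r"] abc
        continuous_on_subset[OF H_continuous, of "{a..b}"] by auto
  qed
  obtain z where z: "z 0 = 0" "z (Suc K) = L" "\<And>i. i < Suc K \<Longrightarrow> \<exists>s. nodal s (z i) (z (Suc i))"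
    using nodal_grid unfolding card by metis
  have zmono: "z i \<le> z (Suc i)" if "i < Suc K" for i
    using z(3)[OF that] by (auto simp: nodal_def)
  define J where "J = (\<lambda>i. integral {z i..z (Suc i)} H)"
  have "integral {0..L} H = (\<Sum>i<Suc K. J i)"
    using integral_sum_over_grid[of "Suc K" z H] zmono z integrable_continuous_real[OF H_continuous]
    by (simp add: J_def)
  hence total: "2 * integral {0..L} H = (\<Sum>i<K. J i + J (Suc i)) + J 0 + J K"
    using sum_of_adjacent_pairs[of J K] by simp
  have pairs: "pi / r \<le> J i + J (Suc i)" "J i + J (Suc i) \<le> pi * r" if i: "i < K" for i
  proof -
    obtain s t where st: "nodal s (z i) (z (Suc i))" "nodal t (z (Suc i)) (z (Suc (Suc i)))"
      using z(3)[of i] z(3)[of "Suc i"] i by auto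
    have "continuous_on {z i..z (Suc (Suc i))} H"
      using st by (intro continuous_on_subset[OF H_continuous]) (auto simp: nodal_def)
    hence "J i + J (Suc i) = integral {z i..z (Suc (Suc i))} H"
      unfolding J_def using zmono[of i] zmono[of "Suc i"] i
      by (intro Henstock_Kurzweil_Integration.integral_combine integrable_continuous_real) auto
    thus "pi / r \<le> J i + J (Suc i)" "J i + J (Suc i) \<le> pi * r"
      using pair[OF st] by auto
  qed
  have singles: "0 \<le> J i" "J i \<le> pi * r" if "i < Suc K" for i
    using z(3)[OF that] single by (auto simp: J_def)
  have "(\<Sum>i<K. pi / r) \<le> (\<Sum>i<K. J i + J (Suc i))"
    using pairs(1) by (intro sum_mono) simp
  thus "real K * (pi / r) \<le> 2 * integral {0..L} H"
    using total singles(1)[of 0] singles(1)[of K] by simp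
  have "(\<Sum>i<K. J i + J (Suc i)) \<le> (\<Sum>i<K. pi * r)"
    using pairs(2) by (intro sum_mono) simp
  thus "2 * integral {0..L} H \<le> (real K + 2) * (pi * r)"
    using total singles(2)[of 0] singles(2)[of K] by (simp add: algebra_simps)
qed

end

section \<open>Asymptotics along the curves\<close>

lemma fucik_curve_obtain_solution:
  assumes "0 < L" "weight L m" "weight L n" "(\<alpha>, \<beta>) \<in> fucik_curve L m n s k"
  obtains u v where "nontrivial_fucik_solution L m n \<alpha> \<beta> u v" "card (nodal_domains L u) = k"
proof -
  obtain u where u: "0 < \<alpha>" "0 < \<beta>" "fucik_solution L m n \<alpha> \<beta> u" "\<exists>x\<in>{0..L}. u x \<noteq> 0"
      "card (nodal_domains L u) = k"
    using assms(4) unfolding fucik_curve_def by blast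
  then obtain v where "\<forall>x\<in>{0..L}. (u has_real_derivative v x) (at x within {0..L})"
      "continuous_on {0..L} v"
      "\<forall>x\<in>{0<..<L}. (v has_real_derivative
              - (\<alpha> * m x * pos_part (u x) - \<beta> * n x * neg_part (u x))) (at x)"
      "u 0 = 0" "u L = 0"
    unfolding fucik_solution_def by blast
  hence "nontrivial_fucik_solution L m n \<alpha> \<beta> u v"
    using u assms by unfold_locales auto
  thus ?thesis using that u by blast
qed

text \<open>The threshold for \<open>k\<close> depends on \<open>\<alpha>\<close> and \<open>\<beta>\<close> only through the bound \<open>T\<close> on their ratio: the scale
\<open>d\<close> on which the weights vary by a factor of at most \<open>r\<^sup>2\<close> is a property of the weights alone, and
the nodal intervals drop below \<open>d / 2\<close> at a rate determined by \<open>T\<close>.\<close>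

lemma fucik_curve_integral_bounds:
  assumes L: "0 < L" and weights: "weight L m" "weight L n" and r: "1 < r" and T: "0 < T"
  shows "\<exists>k0. \<forall>k\<ge>k0. \<forall>\<alpha> \<beta> s. (\<alpha>, \<beta>) \<in> fucik_curve L m n s k \<longrightarrow> \<alpha> \<le> T * \<beta> \<longrightarrow> \<beta> \<le> T * \<alpha> \<longrightarrow>
    (real k - 1) * (pi / r) \<le> 2 * integral {0..L} (harmonic_weight (\<lambda>x. \<alpha> * m x) (\<lambda>x. \<beta> * n x)) \<and>
    2 * integral {0..L} (harmonic_weight (\<lambda>x. \<alpha> * m x) (\<lambda>x. \<beta> * n x)) \<le> (real k + 1) * (pi * r)"
proof -
  obtain c1 M1 where b1: "0 < c1" "0 < M1"
    "\<And>x. x \<in> {0..L} \<Longrightarrow> c1 \<le> m x" "\<And>x. x \<in> {0..L} \<Longrightarrow> m x \<le> M1"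
    using weight_bounds[OF weights(1)] by metis
  obtain c2 M2 where b2: "0 < c2" "0 < M2"
    "\<And>x. x \<in> {0..L} \<Longrightarrow> c2 \<le> n x" "\<And>x. x \<in> {0..L} \<Longrightarrow> n x \<le> M2"
    using weight_bounds[OF weights(2)] by metis
  have r2: "1 < r\<^sup>2" using r by simp
  obtain d1 where d1: "0 < d1"
    "\<And>x y. x \<in> {0..L} \<Longrightarrow> y \<in> {0..L} \<Longrightarrow> \<bar>x - y\<bar> \<le> d1 \<Longrightarrow> m x \<le> r\<^sup>2 * m y"
    using weight_ratio_le[OF weights(1) r2] by metis
  obtain d2 where d2: "0 < d2"
    "\<And>x y. x \<in> {0..L} \<Longrightarrow> y \<in> {0..L} \<Longrightarrow> \<bar>x - y\<bar> \<le> d2 \<Longrightarrow> n x \<le> r\<^sup>2 * n y"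
    using weight_ratio_le[OF weights(2) r2] by metis
  define c where "c = min c1 c2"
  define M where "M = max M1 M2"
  define d where "d = min d1 d2"
  define B where "B = L * sqrt (T * M / c)"
  obtain k0 :: nat where k0: "2 * B / d < real k0" using reals_Archimedean2 by blast
  show ?thesis
  proof (intro exI[of _ "max k0 1"] allI impI)
    fix k \<alpha> \<beta> s
    assume k: "max k0 1 \<le> k" and curve: "(\<alpha>, \<beta>) \<in> fucik_curve L m n s k"
      and ratio: "\<alpha> \<le> T * \<beta>" "\<beta> \<le> T * \<alpha>"
    obtain u v where "nontrivial_fucik_solution L m n \<alpha> \<beta> u v" and card: "card (nodal_domains L u) = k"
      using fucik_curve_obtain_solution[OF L weights curve] by metis
    then interpret nontrivial_fucik_solution L m n \<alpha> \<beta> u v by simp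
    have short: "b - a \<le> d / 2" if "nodal s a b" for s a b
    proof -
      have "real k * (b - a) \<le> B"
        unfolding B_def card[symmetric]
        by (rule nodal_length_uniform[OF _ _ T ratio that])
          (use b1 b2 in \<open>auto simp: c_def M_def min_le_iff_disj le_max_iff_disj\<close>)
      also have "B \<le> real k0 * (d / 2)"
        using k0 d1(1) d2(1) by (simp add: d_def field_simps)
      also have "\<dots> \<le> real k * (d / 2)"
        using k d1(1) d2(1) by (intro mult_right_mono) (auto simp: d_def)
      finally show ?thesis using k by simp
    qed
    have slow: "m x \<le> r\<^sup>2 * m y \<and> n x \<le> r\<^sup>2 * n y"
      if "x \<in> {0..L}" "y \<in> {0..L}" "\<bar>x - y\<bar> \<le> d" for x y
      using d1(2)[of x y] d2(2)[of x y] that by (simp add: d_def)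
    obtain K where K: "k = Suc K" using k by (cases k) auto
    show "(real k - 1) * (pi / r) \<le> 2 * integral {0..L} H \<and> 2 * integral {0..L} H \<le> (real k + 1) * (pi * r)"
      using integral_H_bounds[where K = K, OF _ slow short] r card K by (simp add: add.commute)
  qed
qed

text \<open>The sector stays away from both axes, so the slope \<open>b / a\<close> and, by symmetry, its inverse are at most
the slope \<open>tan (\<pi>/4 + \<theta>/2)\<close> of the upper boundary ray.\<close>

lemma sector_ratio_bound:
  assumes "0 < \<theta>" "\<theta> < pi / 2"
  obtains T where "0 < T" "\<And>a b. (a, b) \<in> sector \<theta> \<Longrightarrow> a \<le> T * b \<and> b \<le> T * a"
proof (rule that)
  define \<phi> where "\<phi> = pi / 4 + \<theta> / 2"
  have \<phi>: "0 < \<phi>" "\<phi> < pi / 2" using assms by (auto simp: \<phi>_def)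
  show "0 < tan \<phi>" by (rule tan_gt_zero[OF \<phi>])
  have slope: "t \<le> tan \<phi>" if "arctan t \<le> \<phi>" for t
  proof -
    have "tan (arctan t) \<le> tan \<phi>"
      using that \<phi> arctan_lbound[of t] by (subst tan_mono_le_eq) auto
    thus ?thesis by (simp add: tan_arctan)
  qed
  fix a b assume "(a, b) \<in> sector \<theta>"
  hence ab: "0 < a" "0 < b" "\<bar>arctan (b / a) - pi / 4\<bar> \<le> \<theta> / 2" by (auto simp: sector_def)
  have "arctan (a / b) = pi / 2 - arctan (b / a)"
    using arctan_inverse[of "b / a"] ab by simp
  hence "arctan (a / b) \<le> \<phi>" "arctan (b / a) \<le> \<phi>"
    using ab(3) unfolding \<phi>_def by linarith+
  thus "a \<le> tan \<phi> * b \<and> b \<le> tan \<phi> * a"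
    using slope[of "a / b"] slope[of "b / a"] ab by (simp add: field_simps)
qed

lemma tendsto_1_if_ratio_bounds:
  fixes A :: "nat \<Rightarrow> real"
  assumes "\<And>R. 1 < R \<Longrightarrow> eventually (\<lambda>k. 1 / R \<le> A k \<and> A k \<le> R) sequentially"
  shows "A \<longlonglongrightarrow> 1"
proof (rule order_tendstoI)
  fix a :: real assume "a < 1"
  define R where "R = 2 / (max a 0 + 1)"
  have "1 < R" "a < 1 / R" using \<open>a < 1\<close> by (auto simp: R_def max_def field_simps)
  thus "eventually (\<lambda>k. a < A k) sequentially"
    using assms[of R] by (auto elim!: eventually_mono)
next
  fix a :: real assume "1 < a"
  hence "1 < (a + 1) / 2" "(a + 1) / 2 < a" by auto
  thus "eventually (\<lambda>k. A k < a) sequentially"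
    using assms[of "(a + 1) / 2"] by (auto elim!: eventually_mono)
qed

theorem theorem1p3:
  fixes L \<theta> s :: real and m n :: "real \<Rightarrow> real" and \<alpha> \<beta> :: "nat \<Rightarrow> real"
  assumes "0 < L"
    and "weight L m" and "weight L n"
    and "0 < \<theta>" and "\<theta> < pi / 2"
    and "s \<in> {1, -1}"
    and "\<forall>k\<ge>1. (\<alpha> k, \<beta> k) \<in> fucik_curve L m n s k \<inter> sector \<theta>"
  defines "A \<equiv> \<lambda>k::nat. pi * real k / 2 *
      inverse (integral {0..L} (harmonic_weight (\<lambda>x. \<alpha> k * m x) (\<lambda>x. \<beta> k * n x)))"
  shows "asymp_equiv (\<lambda>k. 1) at_top A \<and>
    (\<forall>\<gamma>>1. (\<forall>t>0. gamma_condition \<gamma> L (harmonic_weight m (\<lambda>x. n x * t))) \<longrightarrow>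
      (\<forall>\<delta>\<in>{1 / \<gamma>..1}. (\<lambda>k. 1 - A k) \<in> O(\<lambda>k. real k powr \<delta>)))"
proof -
  obtain T where T: "0 < T" "\<And>a b. (a, b) \<in> sector \<theta> \<Longrightarrow> a \<le> T * b \<and> b \<le> T * a"
    using sector_ratio_bound[OF assms(4,5)] by metis
  have "A \<longlonglongrightarrow> 1"
  proof (rule tendsto_1_if_ratio_bounds)
    fix R :: real assume R: "1 < R"
    \<comment> \<open>One factor \<open>r\<close> pays for the variation of the weights, the other for replacing
      \<open>k - 1\<close> and \<open>k + 1\<close> by \<open>k\<close>.\<close>
    define r where "r = sqrt R"
    have r: "1 < r" "r * r = R" using R by (auto simp: r_def)
    obtain k0 where k0: "\<forall>k\<ge>k0. \<forall>\<alpha> \<beta> s. (\<alpha>, \<beta>) \<in> fucik_curve L m n s k \<longrightarrow> \<alpha> \<le> T * \<beta> \<longrightarrow> \<beta> \<le> T * \<alpha> \<longrightarrow>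
      (real k - 1) * (pi / r) \<le> 2 * integral {0..L} (harmonic_weight (\<lambda>x. \<alpha> * m x) (\<lambda>x. \<beta> * n x)) \<and>
      2 * integral {0..L} (harmonic_weight (\<lambda>x. \<alpha> * m x) (\<lambda>x. \<beta> * n x)) \<le> (real k + 1) * (pi * r)"
      using fucik_curve_integral_bounds[OF assms(1-3) r(1) T(1)] by metis
    obtain k1 :: nat where k1: "r / (r - 1) < real k1" using reals_Archimedean2 by blast
    have "1 / R \<le> A k \<and> A k \<le> R" if k: "max k0 (max k1 2) \<le> k" for k
    proof -
      define I where "I = integral {0..L} (harmonic_weight (\<lambda>x. \<alpha> k * m x) (\<lambda>x. \<beta> k * n x))"
      have "(\<alpha> k, \<beta> k) \<in> fucik_curve L m n s k" "(\<alpha> k, \<beta> k) \<in> sector \<theta>"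
        using assms(7) k by auto
      hence I: "(real k - 1) * (pi / r) \<le> 2 * I" "2 * I \<le> (real k + 1) * (pi * r)"
        using k0[rule_format, of k "\<alpha> k" "\<beta> k" s] T(2) k unfolding I_def by simp_all
      have kr: "r < (r - 1) * real k" "2 \<le> real k"
      proof -
        have "r / (r - 1) < real k" using k1 k by linarith
        thus "r < (r - 1) * real k" using r by (simp add: field_simps)
      qed (use k in auto)
      have "real k \<le> r * (real k - 1)" "real k + 1 \<le> r * real k"
        using kr r by (auto simp: algebra_simps)
      hence mono: "real k * (pi / r) \<le> r * (real k - 1) * (pi / r)"
          "(real k + 1) * (pi * r) \<le> r * real k * (pi * r)"
        using r by (intro mult_right_mono; simp)+
      have "r * (real k - 1) * (pi / r) \<le> r * (2 * I)"
        unfolding mult.assoc using I(1) r by (intro mult_left_mono) auto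
      hence I'1: "real k * (pi / r) \<le> r * (2 * I)" using mono(1) by linarith
      have "r * real k * (pi * r) = real k * pi * R" by (simp add: mult_ac flip: r(2))
      hence I'2: "2 * I \<le> real k * pi * R" using I(2) mono(2) by linarith
      have "0 < real k * (pi / r)" using kr r by simp
      hence "0 < I" using I'1 r by (smt (verit) zero_less_mult_iff)
      have "real k * pi \<le> R * (2 * I)"
        using I'1 r by (simp add: field_simps flip: r(2))
      thus ?thesis
        using I'2 \<open>0 < I\<close> R unfolding A_def I_def[symmetric] by (simp add: field_simps)
    qed
    thus "eventually (\<lambda>k. 1 / R \<le> A k \<and> A k \<le> R) sequentially"
      using eventually_sequentially by blast
  qed
  have "(\<lambda>k. 1 / A k) \<longlonglongrightarrow> 1"
    using tendsto_divide[OF tendsto_const \<open>A \<longlonglongrightarrow> 1\<close>, of 1] by simp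
  hence "asymp_equiv (\<lambda>k. 1) at_top A" by (rule asymp_equivI')
  \<comment> \<open>Convergence bounds \<open>1 - A k\<close>, while \<open>k powr \<delta>\<close> is at least 1 because \<open>\<delta> \<ge> 1/\<gamma> > 0\<close>.\<close>
  moreover have "(\<lambda>k. 1 - A k) \<in> O(\<lambda>k. real k powr \<delta>)" if "1 < \<gamma>" "\<delta> \<in> {1 / \<gamma>..1}" for \<gamma> \<delta>
  proof (rule bigoI[where c = 1])
    have "0 < 1 / \<gamma>" using that by simp
    hence \<delta>: "0 < \<delta>" using that(2) unfolding atLeastAtMost_iff by linarith
    have "eventually (\<lambda>k. dist (A k) 1 < 1) sequentially"
      using \<open>A \<longlonglongrightarrow> 1\<close> by (rule tendstoD) simp
    thus "eventually (\<lambda>k. norm (1 - A k) \<le> 1 * norm (real k powr \<delta>)) at_top"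
      using eventually_ge_at_top[of "1::nat"]
    proof eventually_elim
      case (elim k)
      have "1 \<le> real k powr \<delta>" using elim \<delta> by (intro ge_one_powr_ge_zero) auto
      thus ?case using elim by (simp add: dist_real_def abs_minus_commute)
    qed
  qed
  ultimately show ?thesis by blast
qed

end
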